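(* Let $n,r$ be positive integers with $n\ge r$, and let $k_1,\dots,k_r$ be integers. Then $$\frac{1}{r!}\sum_{m=r}^n {m \brace k_1,k_2,\cdots,k_r} S_1(n,m) = \sum_{j=r}^n {j \brace r}(-1)^{j-r} \binom{n}{j}B_{n-j}^{(k_1,k_2,\cdots,k_r)},$$ where ${m \brace k_1,\cdots,k_r}$ is the multi-Stirling number of the second kind, $S_1(n,m)$ is the (signed) Stirling number of the first kind, ${j \brace r}$ is the ordinary Stirling number of the second kind, and $B_{m}^{(k_1,\cdots,k_r)}$ is the multi-Bernoulli number.
   Context: For integers $k_1,\dots,k_r$ the multiple logarithm of index $(k_1,\dots,k_r)$ is the power series $$\mathrm{Li}_{k_1,k_2,\cdots,k_r}(t)=\sum_{0<m_1<m_2<\cdots<m_r}\frac{t^{m_r}}{m_1^{k_1}m_2^{k_2}\cdots m_r^{k_r}},$$ the sum being over integers $m_1,\dots,m_r$. The multi-Stirling numbers of the second kind ${n \brace k_1,k_2,\cdots,k_r}$ are defined by the generating function (as a power series in $t$) $$\mathrm{Li}_{k_1,k_2,\cdots,k_r}(1-e^{1-e^t})=\sum_{n=r}^\infty {n \brace k_1,k_2,\cdots,k_r}\frac{t^n}{n!}.$$ The multi-Bernoulli numbers $B_n^{(k_1,k_2,\cdots,k_r)}$ are defined by $$\frac{1}{(1-e^{-t})^r}\mathrm{Li}_{k_1,\cdots,k_r}(1-e^{-t})=\sum_{n=0}^\infty B_n^{(k_1,k_2,\cdots,k_r)}\frac{t^n}{n!}.$$ The signed Stirling numbers of the first kind $S_1(n,k)$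 are defined by $(x)_n=\sum_{k=0}^n S_1(n,k)x^k$ for $n\ge0$, where $(x)_0=1$ and $(x)_n=x(x-1)\cdots(x-n+1)$ for $n\ge1$. The Stirling numbers of the second kind ${n \brace k}$ are given by $\frac{1}{k!}(e^t-1)^k=\sum_{n=k}^\infty {n \brace k}\frac{t^n}{n!}$ for $k\ge 0$. In the claim, ${j \brace r}$ denotes this ordinary Stirling number (not a multi-Stirling number with a one-term index). *)

theory Defs
  imports
    "HOL-Computational_Algebra.Computational_Algebra"
    "HOL-Combinatorics.Stirling"
begin

text \<open>All power series have rational coefficients. An index
  \<open>(k\<^sub>1, \<dots>, k\<^sub>r)\<close> is a nonempty list of integers, so that
  \<open>r = length ks\<close>; for the empty list the constants below have no meaning.\<close>

text \<open>The tuples \<open>0 < m\<^sub>1 < \<dots> < m\<^sub>r = n\<close>.\<close>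

definition Li_tuples :: "nat \<Rightarrow> nat \<Rightarrow> nat list set" where
  "Li_tuples r n = {ms. length ms = r \<and> sorted_wrt (<) (0 # ms) \<and> last ms = n}"

definition multi_Li :: "int list \<Rightarrow> rat fps" where
  "multi_Li ks =
     Abs_fps (\<lambda>n. \<Sum>ms\<in>Li_tuples (length ks) n.
                    1 / (\<Prod>i<length ks. of_nat (ms ! i) powi (ks ! i)))"

definition multi_Stirling :: "nat \<Rightarrow> int list \<Rightarrow> rat" where
  "multi_Stirling n ks =
     fact n * fps_nth (multi_Li ks oo (1 - (fps_exp 1 oo (1 - fps_exp 1)))) n"

text \<open>Here \<open>/\<close> is the library's division of formal power series; see
  \<open>multi_Bernoulli_egf\<close> for the fact that the quotient is exact.\<close>

definition multi_Bernoulli :: "nat \<Rightarrow> int list \<Rightarrow> rat" where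
  "multi_Bernoulli n ks =
     fact n * fps_nth ((multi_Li ks oo (1 - fps_exp (-1))) / (1 - fps_exp (-1)) ^ length ks) n"

definition falling_factorial_poly :: "nat \<Rightarrow> int poly" where
  "falling_factorial_poly n = (\<Prod>i<n. [:- int i, 1:])"

definition S1 :: "nat \<Rightarrow> nat \<Rightarrow> int" where
  "S1 n k = coeff (falling_factorial_poly n) k"

lemma sorted_wrt_less_nth_ge:
  fixes a :: nat
  assumes "sorted_wrt (<) (a # ms)" "i < length ms"
  shows "a + Suc i \<le> ms ! i"
  using assms
proof (induction ms arbitrary: a i)
  case (Cons b ms)
  show ?case
  proof (cases i)
    case 0
    with Cons.prems show ?thesis by simp
  next
    case (Suc j)
    have "b + Suc j \<le> ms ! j"
      using Cons.prems Suc by (intro Cons.IH) auto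
    with Cons.prems Suc show ?thesis by simp
  qed
qed simp

lemma finite_Li_tuples:
  assumes "r > 0"
  shows "finite (Li_tuples r n)"
proof (rule finite_subset)
  show "Li_tuples r n \<subseteq> {ms. set ms \<subseteq> {..n} \<and> length ms = r}"
  proof (clarsimp simp: Li_tuples_def)
    fix ms x
    assume ms: "x \<in> set ms" "sorted_wrt (<) ms" "r = length ms" "n = last ms"
    then obtain i where i: "i < length ms" "x = ms ! i"
      by (auto simp: in_set_conv_nth)
    have "ms ! i \<le> ms ! (length ms - 1)"
      using ms(2) i by (cases "i = length ms - 1") (auto simp: sorted_wrt_iff_nth_less less_imp_le)
    then show "x \<le> last ms"
      using i by (metis last_conv_nth length_0_conv not_less_zero)
  qed
qed (simp add: finite_lists_length_eq)

lemma Li_tuples_eq_empty: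
  assumes "r > 0" "n < r"
  shows "Li_tuples r n = {}"
proof (rule equals0I)
  fix ms assume "ms \<in> Li_tuples r n"
  then have ms: "length ms = r" "sorted_wrt (<) (0 # ms)" "last ms = n"
    by (auto simp: Li_tuples_def)
  have "0 + Suc (r - 1) \<le> ms ! (r - 1)"
    using ms assms by (intro sorted_wrt_less_nth_ge) auto
  with ms assms show False
    by (cases "ms = []") (auto simp: last_conv_nth)
qed

lemma multi_Li_eq_shift:
  assumes "ks \<noteq> []"
  shows "multi_Li ks = fps_X ^ length ks * fps_shift (length ks) (multi_Li ks)"
proof (rule fps_ext)
  fix n
  show "fps_nth (multi_Li ks) n =
        fps_nth (fps_X ^ length ks * fps_shift (length ks) (multi_Li ks)) n"
    using assms by (auto simp: fps_X_power_mult_nth multi_Li_def Li_tuples_eq_empty)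
qed

lemma multi_Bernoulli_egf:
  assumes "ks \<noteq> []"
  shows "(1 - fps_exp (-1)) ^ length ks * Abs_fps (\<lambda>n. multi_Bernoulli n ks / fact n) =
         multi_Li ks oo (1 - fps_exp (-1))"
proof -
  let ?r = "length ks"
  define u :: "rat fps" where "u = 1 - fps_exp (-1)"
  have u0: "fps_nth u 0 = 0" by (simp add: u_def)
  have "fps_nth u 1 \<noteq> 0" by (simp add: u_def)
  then have "u \<noteq> 0" by auto
  have "multi_Li ks oo u = (fps_X ^ ?r * fps_shift ?r (multi_Li ks)) oo u"
    using multi_Li_eq_shift[OF assms] by simp
  also have "\<dots> = u ^ ?r * (fps_shift ?r (multi_Li ks) oo u)"
    using u0 by (simp add: fps_compose_mult_distrib fps_compose_power[symmetric])
  finally have "u ^ ?r dvd (multi_Li ks oo u)" by simp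
  then have "u ^ ?r * ((multi_Li ks oo u) / u ^ ?r) = multi_Li ks oo u"
    by (rule dvd_mult_div_cancel)
  moreover have "Abs_fps (\<lambda>n. multi_Bernoulli n ks / fact n) = (multi_Li ks oo u) / u ^ ?r"
    by (rule fps_ext) (simp add: multi_Bernoulli_def u_def)
  ultimately show ?thesis by (simp add: u_def)
qed

text \<open>The library defines \<^const>\<open>Stirling\<close> by its recurrence.\<close>

lemma Stirling_egf:
  "fps_const (1 / fact k) * (fps_exp 1 - 1) ^ k =
     Abs_fps (\<lambda>n. of_nat (Stirling n k) / fact n :: rat)"
proof -
  define F :: "nat \<Rightarrow> rat fps" where
    "F = (\<lambda>k. fps_const (1 / fact k) * (fps_exp 1 - 1) ^ k)"
  have F_nth_0: "fps_nth (F k) 0 = (if k = 0 then 1 else 0)" for k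
    by (simp add: F_def)
  have deriv: "fps_deriv (F (Suc k)) = fps_const (of_nat (Suc k)) * F (Suc k) + F k" for k
  proof -
    have c: "fps_const (1 / fact k) = fps_const (of_nat (Suc k)) * fps_const (1 / fact (Suc k) :: rat)"
      by (simp add: field_simps del: of_nat_Suc)
    have "fps_deriv (F (Suc k)) =
          fps_const (1 / fact (Suc k)) *
            (fps_const (of_nat (Suc k)) * fps_exp 1 * (fps_exp 1 - 1) ^ k)"
      unfolding F_def fps_deriv_mult fps_deriv_power
      by (simp del: of_nat_Suc fact_Suc power_Suc)
    also have "\<dots> = fps_const (of_nat (Suc k)) * F (Suc k) + F k"
      unfolding F_def c by (simp add: algebra_simps del: of_nat_Suc fact_Suc fps_const_mult)
    finally show ?thesis .
  qed
  have "fact n * fps_nth (F k) n = of_nat (Stirling n k)" for n k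
  proof (induction n k rule: Stirling.induct)
    case (4 n k)
    have "of_nat (Suc n) * fps_nth (F (Suc k)) (Suc n) =
          of_nat (Suc k) * fps_nth (F (Suc k)) n + fps_nth (F k) n"
      using arg_cong[OF deriv[of k], of "\<lambda>f. fps_nth f n"] by simp
    then have "fact (Suc n) * fps_nth (F (Suc k)) (Suc n) =
          fact n * (of_nat (Suc k) * fps_nth (F (Suc k)) n + fps_nth (F k) n)"
      by (metis fact_Suc mult.assoc mult.commute)
    also have "\<dots> = of_nat (Suc k) * (fact n * fps_nth (F (Suc k)) n) + fact n * fps_nth (F k) n"
      by (simp add: algebra_simps)
    finally show ?case unfolding 4 by (simp add: algebra_simps)
  qed (simp_all add: F_nth_0, simp add: F_def)
  then have "fps_nth (F k) n = of_nat (Stirling n k) / fact n" for n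
    by (simp add: field_simps)
  then show ?thesis by (intro fps_ext) (simp add: F_def)
qed

end

theory Submission
  imports Defs
begin

text \<open>Put \<open>G(u) = Li\<^bsub>k\<^esub>(1 - e\<^sup>-\<^sup>u)\<close>, where \<open>k\<close> is the given index. Both sides of the identity
  are the number \<open>n! [u\<^sup>n] G(u) / r!\<close>.

  On the left, \<open>1 - e\<^bsup>1 - e^t\<^esup>\<close> is the value of \<open>1 - e\<^sup>-\<^sup>u\<close> at \<open>u = e\<^sup>t - 1\<close>, so the multi-Stirling
  numbers have the exponential generating function \<open>G(e\<^sup>t - 1)\<close>. Expanding in powers of
  \<open>e\<^sup>t - 1\<close> shows that they are the transform of \<open>m! [u\<^sup>m] G(u)\<close> by the matrix of Stirling
  numbers of the second kind (\<open>multi_Stirling_as_Stirling_transform\<close>). The matrix \<^const>\<open>S1\<close>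
  is inverse to it (\<open>S1_Stirling_orthogonal\<close>) and undoes the transform.

  On the right, the definition of the multi-Bernoulli numbers says that \<open>G(t)\<close> is
  \<open>(1 - e\<^sup>-\<^sup>t)\<^sup>r\<close> times their exponential generating function. The first factor, divided
  by \<open>r!\<close>, generates the Stirling numbers \<open>(-1)\<^bsup>j-r\<^esup> Stirling j r\<close>, and the product
  of the two series is the binomial convolution in the statement.\<close>

lemma S1_0: "S1 0 m = (if m = 0 then 1 else 0)"
  by (simp add: S1_def falling_factorial_poly_def)

lemma falling_factorial_poly_Suc:
  "falling_factorial_poly (Suc n) = [:- int n, 1:] * falling_factorial_poly n"
  by (simp add: falling_factorial_poly_def mult.commute)

lemma S1_Suc_0: "S1 (Suc n) 0 = - int n * S1 n 0"
  by (simp add: S1_def falling_factorial_poly_Suc)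

lemma S1_Suc_Suc: "S1 (Suc n) (Suc m) = S1 n m - int n * S1 n (Suc m)"
  by (simp add: S1_def falling_factorial_poly_Suc)

lemma S1_eq_0: "n < m \<Longrightarrow> S1 n m = 0"
proof (induction n arbitrary: m)
  case (Suc n)
  then show ?case by (cases m) (simp_all add: S1_Suc_Suc)
qed (simp add: S1_0)

text \<open>Passing from row \<open>n\<close> of \<^const>\<open>S1\<close> to the next multiplies the falling factorial polynomial by
  \<open>x - n\<close>. The recurrence of \<^const>\<open>Stirling\<close> turns multiplication by \<open>x\<close> into
  \<open>l\<close> times entry \<open>l\<close> of the product plus entry \<open>l - 1\<close>. So if
  row \<open>n\<close> of the product is the unit vector at \<open>n\<close>, the factors \<open>n\<close> cancel and the
  next row is the unit vector at \<open>n + 1\<close>.\<close>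

lemma S1_Stirling_orthogonal:
  "(\<Sum>m\<le>n. S1 n m * int (Stirling m l)) = (if l = n then 1 else 0)"
proof (induction n arbitrary: l)
  case 0
  show ?case by (cases l) (simp_all add: S1_0)
next
  case (Suc n)
  have shifted: "(\<Sum>m\<le>n. S1 n m * int (Stirling (Suc m) l)) =
      int l * (\<Sum>m\<le>n. S1 n m * int (Stirling m l)) + (if l = Suc n then 1 else 0)"
  proof (cases l)
    case (Suc k)
    have "(\<Sum>m\<le>n. S1 n m * int (Stirling (Suc m) l)) =
        int l * (\<Sum>m\<le>n. S1 n m * int (Stirling m l)) + (\<Sum>m\<le>n. S1 n m * int (Stirling m k))"
      unfolding Suc by (simp add: algebra_simps sum.distrib sum_distrib_left)
    then show ?thesis using Suc.IH[of k] Suc by simp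
  qed simp
  have "(\<Sum>m\<le>Suc n. S1 (Suc n) m * int (Stirling m l)) =
      S1 (Suc n) 0 * int (Stirling 0 l) + (\<Sum>m\<le>n. S1 (Suc n) (Suc m) * int (Stirling (Suc m) l))"
    by (rule sum.atMost_Suc_shift)
  also have "\<dots> = (\<Sum>m\<le>n. S1 n m * int (Stirling (Suc m) l)) -
      int n * (S1 n 0 * int (Stirling 0 l) + (\<Sum>m\<le>n. S1 n (Suc m) * int (Stirling (Suc m) l)))"
    by (simp add: S1_Suc_0 S1_Suc_Suc algebra_simps sum_subtractf sum_distrib_left
        del: Stirling.simps)
  also have "S1 n 0 * int (Stirling 0 l) + (\<Sum>m\<le>n. S1 n (Suc m) * int (Stirling (Suc m) l)) =
      (\<Sum>m\<le>Suc n. S1 n m * int (Stirling m l))"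
    by (rule sum.atMost_Suc_shift[symmetric])
  also have "\<dots> = (\<Sum>m\<le>n. S1 n m * int (Stirling m l))"
    by (simp add: S1_eq_0)
  finally show ?case
    using Suc.IH[of l] shifted by (simp split: if_splits)
qed

lemma Stirling_transform_inverse:
  fixes a :: "nat \<Rightarrow> 'a::comm_ring_1"
  shows "(\<Sum>m\<le>n. (\<Sum>l\<le>m. of_nat (Stirling m l) * a l) * of_int (S1 n m)) = a n"
proof -
  \<comment> \<open>\<^const>\<open>Stirling\<close> vanishes above the diagonal, so all inner sums can run to \<open>n\<close>.\<close>
  have "(\<Sum>m\<le>n. (\<Sum>l\<le>m. of_nat (Stirling m l) * a l) * of_int (S1 n m)) =
      (\<Sum>m\<le>n. \<Sum>l\<le>n. a l * of_int (S1 n m * int (Stirling m l)))"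
  proof (rule sum.cong[OF refl])
    fix m assume "m \<in> {..n}"
    then have "(\<Sum>l\<le>m. of_nat (Stirling m l) * a l) = (\<Sum>l\<le>n. of_nat (Stirling m l) * a l)"
      by (intro sum.mono_neutral_left) auto
    then show "(\<Sum>l\<le>m. of_nat (Stirling m l) * a l) * of_int (S1 n m) =
        (\<Sum>l\<le>n. a l * of_int (S1 n m * int (Stirling m l)))"
      by (simp add: sum_distrib_left mult_ac)
  qed
  also have "\<dots> = (\<Sum>l\<le>n. a l * of_int (\<Sum>m\<le>n. S1 n m * int (Stirling m l)))"
    by (subst sum.swap) (simp add: sum_distrib_left)
  also have "\<dots> = a n"
    by (simp add: S1_Stirling_orthogonal if_distrib cong: if_cong)
  finally show ?thesis .
qed

lemma fps_nth_exp_minus_1_power: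
  "fps_nth ((fps_exp 1 - 1) ^ k) n = (fact k * of_nat (Stirling n k) / fact n :: rat)"
  using arg_cong[OF Stirling_egf[of k], of "\<lambda>f. fps_nth f n"] by (simp add: field_simps)

lemma fps_compose_exp_minus_1_nth:
  fixes G :: "rat fps"
  shows "fact m * fps_nth (G oo (fps_exp 1 - 1)) m =
      (\<Sum>l\<le>m. of_nat (Stirling m l) * (fact l * fps_nth G l))"
  by (simp add: fps_compose_nth fps_nth_exp_minus_1_power sum_distrib_left atLeast0AtMost
      mult_ac)

text \<open>The sign comes from substituting \<open>-t\<close> for \<open>t\<close> in \<open>(e\<^sup>t - 1)\<^sup>r\<close> and pulling
  \<open>(-1)\<^sup>r\<close> out of the power. The truncated difference \<open>n - r\<close> is harmless because the
  Stirling number is \<open>0\<close> for \<open>n < r\<close>.\<close>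

lemma fps_nth_one_minus_exp_power:
  "fps_nth ((1 - fps_exp (-1)) ^ r) n =
     (fact r * (of_nat (Stirling n r) * (-1) ^ (n - r)) / fact n :: rat)"
proof -
  let ?w = "fps_const (-1) * fps_X :: rat fps"
  have "(1 - fps_exp (-1) :: rat fps) = fps_const (-1) * ((fps_exp 1 - 1) oo ?w)"
    by (rule fps_ext) (simp add: fps_compose_linear fps_compose_sub_distrib)
  then have "(1 - fps_exp (-1) :: rat fps) ^ r =
      fps_const ((-1) ^ r) * ((fps_exp 1 - 1) ^ r oo ?w)"
    by (simp add: power_mult_distrib fps_const_power fps_compose_power)
  then have "fps_nth ((1 - fps_exp (-1)) ^ r) n =
      (-1) ^ r * ((-1) ^ n * (fact r * of_nat (Stirling n r) / fact n :: rat))"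
    by (simp add: fps_compose_linear fps_nth_exp_minus_1_power)
  also have "\<dots> = fact r * (of_nat (Stirling n r) * (-1) ^ (n - r)) / fact n"
  proof (cases "r \<le> n")
    case True
    then have "(-1) ^ r * (-1) ^ n = ((-1) ^ (n - r) :: rat)"
      by (cases "even n"; cases "even r") simp_all
    then show ?thesis by (simp add: mult_ac)
  qed simp
  finally show ?thesis .
qed

lemma multi_Stirling_egf_compose:
  "multi_Li ks oo (1 - (fps_exp 1 oo (1 - fps_exp 1))) =
     (multi_Li ks oo (1 - fps_exp (-1))) oo (fps_exp 1 - 1)"
proof -
  let ?v = "fps_exp 1 - 1 :: rat fps"
  have "fps_exp (-1) = fps_exp 1 oo (fps_const (-1) * fps_X :: rat fps)"
    by (rule fps_ext) (simp add: fps_compose_linear)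
  then have "fps_exp (-1) oo ?v = fps_exp 1 oo ((fps_const (-1) * fps_X) oo ?v)"
    by (simp add: fps_compose_assoc)
  also have "(fps_const (-1) * fps_X) oo ?v = 1 - fps_exp 1"
    by (simp add: fps_compose_uminus flip: fps_const_neg)
  finally have "(1 - fps_exp (-1)) oo ?v = 1 - (fps_exp 1 oo (1 - fps_exp 1))"
    by (simp add: fps_compose_sub_distrib)
  then show ?thesis
    by (simp flip: fps_compose_assoc)
qed

lemma multi_Stirling_as_Stirling_transform:
  "multi_Stirling m ks =
     (\<Sum>l\<le>m. of_nat (Stirling m l) * (fact l * fps_nth (multi_Li ks oo (1 - fps_exp (-1))) l))"
  unfolding multi_Stirling_def multi_Stirling_egf_compose by (rule fps_compose_exp_minus_1_nth)

text \<open>The series starts in degree \<open>r\<close>; this makes the sum over \<open>m \<ge> r\<close>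
  in the theorem a full Stirling transform.\<close>

lemma multi_Stirling_eq_0:
  assumes "ks \<noteq> []" and "m < length ks"
  shows "multi_Stirling m ks = 0"
proof -
  have "fps_nth (multi_Li ks) i = 0" if "i \<le> m" for i
    using assms that by (simp add: multi_Li_def Li_tuples_eq_empty)
  then show ?thesis
    by (simp add: multi_Stirling_def fps_compose_nth)
qed

lemma fps_nth_multi_Li_one_minus_exp:
  assumes "ks \<noteq> []"
  shows "fact n * fps_nth (multi_Li ks oo (1 - fps_exp (-1))) n =
    fact (length ks) * (\<Sum>j\<le>n. of_nat (Stirling j (length ks)) * (-1) ^ (j - length ks) *
      of_nat (n choose j) * multi_Bernoulli (n - j) ks)"
proof -
  have "fps_nth (multi_Li ks oo (1 - fps_exp (-1))) n =
      (\<Sum>j\<le>n. fact (length ks) * (of_nat (Stirling j (length ks)) * (-1) ^ (j - length ks)) / fact j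
        * (multi_Bernoulli (n - j) ks / fact (n - j)))"
    unfolding multi_Bernoulli_egf[OF assms, symmetric]
    by (simp add: fps_mult_nth fps_nth_one_minus_exp_power atLeast0AtMost)
  then show ?thesis
    by (simp add: sum_distrib_left binomial_fact field_simps)
qed

theorem theorem7:
  fixes n r :: nat and ks :: "int list"
  assumes "r \<ge> 1" and "n \<ge> r" and "length ks = r"
  shows "1 / fact r * (\<Sum>m=r..n. multi_Stirling m ks * of_int (S1 n m)) =
         (\<Sum>j=r..n. of_nat (Stirling j r) * (-1) ^ (j - r) * of_nat (n choose j)
                     * multi_Bernoulli (n - j) ks)"
proof -
  have ks: "ks \<noteq> []" using assms by auto
  have "(\<Sum>m=r..n. multi_Stirling m ks * of_int (S1 n m)) =
      (\<Sum>m\<le>n. multi_Stirling m ks * of_int (S1 n m))"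
    by (rule sum.mono_neutral_left) (use assms ks multi_Stirling_eq_0 in auto)
  also have "\<dots> = fact n * fps_nth (multi_Li ks oo (1 - fps_exp (-1))) n"
    unfolding multi_Stirling_as_Stirling_transform by (rule Stirling_transform_inverse)
  also have "\<dots> = fact r * (\<Sum>j\<le>n. of_nat (Stirling j r) * (-1) ^ (j - r) *
      of_nat (n choose j) * multi_Bernoulli (n - j) ks)"
    using fps_nth_multi_Li_one_minus_exp[OF ks] assms by simp
  also have "(\<Sum>j\<le>n. of_nat (Stirling j r) * (-1) ^ (j - r) *
      of_nat (n choose j) * multi_Bernoulli (n - j) ks) =
      (\<Sum>j=r..n. of_nat (Stirling j r) * (-1) ^ (j - r) *
      of_nat (n choose j) * multi_Bernoulli (n - j) ks)"
    by (rule sum.mono_neutral_right) auto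
  finally show ?thesis by simp
qed

end
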